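(* The algorithm PA-III is stable, i.e., for each $n\in\{0,\dots,N-1\}$ and each $k\ge 0$ its iterates satisfy $$\|U_{n+1}^{k+1}\|\le \|u^{0}\|+(n+1)\Big(\max_{0\le j\le n}\|U_j^{k}\|\Big).$$
   Context: Let $h>0$, let $N_x\ge 3$ be an integer, and let $D_h=\frac1{h^2}\,\mathrm{tridiag}(1,-2,1)\in\mathbb{R}^{(N_x-2)\times(N_x-2)}$ be the discrete Dirichlet Laplacian (diagonal entries $-2/h^2$, sub- and superdiagonal entries $1/h^2$, all others $0$). Let $\epsilon>0$, $T>0$, integers $N\ge1$ and $J\ge2$, $\Delta T=T/N$, $\Delta t=\Delta T/J$, $T_n=n\Delta T$. $\|\cdot\|$ is the Euclidean norm on $\mathbb{R}^{N_x-2}$ and the induced matrix norm. For $i\in\{1,2\}$ set $$P_i=(I-i\Delta T D_h+\epsilon^2\Delta T D_h^2)^{-1}(I-i\Delta T D_h),\qquad P_{J_i}=\Big[\big(I-\tfrac{i\Delta T}{J}D_h+\epsilon^2\tfrac{\Delta T}{J}D_h^2\big)^{-1}\big(I-\tfrac{i\Delta T}{J}D_h\big)\Big]^J .$$ Parareal iteration: given a fine propagator $\mathcal F$ and a coarse propagator $\mathcal G$ (maps $\mathbb{R}^{N_x-2}\to\mathbb{R}^{N_x-2}$ advancing the solution from $T_n$ to $T_{n+1}$) and $u^0\in\mathbb{R}^{N_x-2}$, the initial guess is $U_0^0=u^0$, $U_{n+1}^0=\mathcal G(U_n^0)$, and for $k=0,1,2,\dots$ $$U_0^{k+1}=u^0,\qquad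 U_{n+1}^{k+1}=\mathcal G(U_n^{k+1})+\mathcal F(U_n^k)-\mathcal G(U_n^k),\quad 0\le n\le N-1.$$ PA-III (in the form analyzed): the Parareal iteration with $\mathcal F(U)=P_{J_2}U$ and $\mathcal G(U)=P_1U$. Here $\mathcal F$ consists of $J$ steps of size $\Delta t$ of the scheme $\frac{W^{n+1}-W^n}{\Delta t}=D_h\,\mathrm{diag}(W^n)^2W^{n}-3D_hW^n-\epsilon^2D_h^2W^{n+1}+2D_hW^{n+1}$ and $\mathcal G$ is one step of size $\Delta T$ (i.e. with $\Delta t$ replaced by $\Delta T$) of the scheme $\frac{W^{n+1}-W^n}{\Delta t}=D_h\,\mathrm{diag}(W^n)^2W^{n+1}-\epsilon^2D_h^2W^{n+1}-D_hW^n$, both for the Cahn-Hilliard equation and both with $\mathrm{diag}(W^n)^2$ replaced by $I$. *)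

theory Defs
  imports "HOL-Analysis.Analysis"
begin

text \<open>
  Vectors of length \<open>N\<^sub>x - 2\<close> are modelled as \<open>real ^ 'n\<close> with \<open>CARD('n) = N\<^sub>x - 2\<close>.
  The grid points need an order for ``tridiagonal'' to make sense, so \<open>'n\<close> is a finite
  linearly ordered type, and an index \<open>i\<close> is identified with its position
  \<open>0, \<dots>, CARD('n) - 1\<close> in that order.
\<close>

definition index_pos :: "'n::{finite,linorder} \<Rightarrow> nat"
  where "index_pos i = card {..<i}"

definition Dh :: "real \<Rightarrow> real ^ ('n::{finite,linorder}) ^ ('n::{finite,linorder})"
  where "Dh h = (\<chi> i j.
    if i = j then - 2 / h\<^sup>2
    else if index_pos i = Suc (index_pos j) \<or> index_pos j = Suc (index_pos i) then 1 / h\<^sup>2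
    else 0)"

text \<open>
  The operation \<open>^\<close> provided by the type class instance of \<open>real ^ 'n ^ 'n\<close> is
  the componentwise power, hence a separate power with respect to \<open>**\<close>.
\<close>

primrec matrix_power :: "real ^ 'n ^ 'n \<Rightarrow> nat \<Rightarrow> real ^ 'n ^ 'n"
  where
    "matrix_power A 0 = mat 1"
  | "matrix_power A (Suc m) = A ** matrix_power A m"

text \<open>
  \<open>step_matrix i h \<epsilon> \<tau>\<close> advances one step of size \<open>\<tau>\<close> of the linearised semi-implicit scheme
  \<open>(W' - W) / \<tau> = - i D\<^sub>h W - \<epsilon>\<^sup>2 D\<^sub>h\<^sup>2 W' + i D\<^sub>h W'\<close>.
  For \<open>i = 1\<close> this is
  \<open>(W' - W) / \<tau> = D\<^sub>h diag(W)\<^sup>2 W' - \<epsilon>\<^sup>2 D\<^sub>h\<^sup>2 W' - D\<^sub>h W\<close>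
  and for \<open>i = 2\<close> it is
  \<open>(W' - W) / \<tau> = D\<^sub>h diag(W)\<^sup>2 W - 3 D\<^sub>h W - \<epsilon>\<^sup>2 D\<^sub>h\<^sup>2 W' + 2 D\<^sub>h W'\<close>,
  in both cases with \<open>diag(W)\<^sup>2\<close> replaced by the identity.
\<close>

definition step_matrix ::
    "nat \<Rightarrow> real \<Rightarrow> real \<Rightarrow> real \<Rightarrow> real ^ ('n::{finite,linorder}) ^ ('n::{finite,linorder})"
  where "step_matrix i h \<epsilon> \<tau> =
    matrix_inv (mat 1 - (real i * \<tau>) *\<^sub>R Dh h + (\<epsilon>\<^sup>2 * \<tau>) *\<^sub>R (Dh h ** Dh h))
      ** (mat 1 - (real i * \<tau>) *\<^sub>R Dh h)"

definition P_coarse ::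
    "nat \<Rightarrow> real \<Rightarrow> real \<Rightarrow> real \<Rightarrow> real ^ ('n::{finite,linorder}) ^ ('n::{finite,linorder})"
  where "P_coarse i h \<epsilon> \<Delta>T = step_matrix i h \<epsilon> \<Delta>T"

definition P_fine ::
    "nat \<Rightarrow> nat \<Rightarrow> real \<Rightarrow> real \<Rightarrow> real \<Rightarrow> real ^ ('n::{finite,linorder}) ^ ('n::{finite,linorder})"
  where "P_fine J i h \<epsilon> \<Delta>T = matrix_power (step_matrix i h \<epsilon> (\<Delta>T / real J)) J"

text \<open>\<open>parareal F G u0 k n\<close> is the iterate \<open>U\<^sub>n\<^sup>k\<close>: iteration number first, time index second.\<close>

fun parareal ::
    "('a::ab_group_add \<Rightarrow> 'a) \<Rightarrow> ('a \<Rightarrow> 'a) \<Rightarrow> 'a \<Rightarrow> nat \<Rightarrow> nat \<Rightarrow> 'a"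
  where
    "parareal F G u0 0 0 = u0"
  | "parareal F G u0 0 (Suc n) = G (parareal F G u0 0 n)"
  | "parareal F G u0 (Suc k) 0 = u0"
  | "parareal F G u0 (Suc k) (Suc n) =
       G (parareal F G u0 (Suc k) n) + F (parareal F G u0 k n) - G (parareal F G u0 k n)"

definition PA_III ::
    "real \<Rightarrow> real \<Rightarrow> real \<Rightarrow> nat \<Rightarrow> nat \<Rightarrow> real ^ ('n::{finite,linorder})
      \<Rightarrow> nat \<Rightarrow> nat \<Rightarrow> real ^ ('n::{finite,linorder})"
  where "PA_III h \<epsilon> T N J u0 =
    (let \<Delta>T = T / real N
     in parareal (\<lambda>U. P_fine J 2 h \<epsilon> \<Delta>T *v U) (\<lambda>U. P_coarse 1 h \<epsilon> \<Delta>T *v U) u0)"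

end

theory Submission
  imports Defs
begin

text \<open>
  One step of the scheme applies the rational function
  \<open>(1 - a\<lambda>) / (1 - a\<lambda> + b\<lambda>\<^sup>2)\<close>, with \<open>a, b \<ge> 0\<close>, to the Laplacian. The Laplacian is symmetric
  with spectrum in \<open>(-\<infinity>, 0]\<close>, and there this function has values in \<open>[0, 1]\<close>. Hence the
  coarse propagator \<open>\<G>\<close> and the fine propagator \<open>\<F>\<close>, a power of such a step, are both
  symmetric with \<open>0 \<le> \<F>, \<G> \<le> I\<close>. It follows that \<open>\<parallel>\<G>\<parallel> \<le> 1\<close>, and that
  \<open>-I \<le> \<F> - \<G> \<le> I\<close>, so \<open>\<parallel>\<F> - \<G>\<parallel> \<le> 1\<close>: subtracting two numbers of \<open>[0, 1]\<close> cannot leave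
  \<open>[-1, 1]\<close>. The positivity of both propagators is what gives the constant \<open>1\<close> here; two mere
  contractions would give \<open>2\<close>. The iteration then satisfies
  \<open>\<parallel>U\<^sub>n\<^sub>+\<^sub>1\<^sup>k\<^sup>+\<^sup>1\<parallel> \<le> \<parallel>U\<^sub>n\<^sup>k\<^sup>+\<^sup>1\<parallel> + \<parallel>U\<^sub>n\<^sup>k\<parallel>\<close>, which is summed over \<open>n\<close>.

  The argument is carried out with quadratic forms, so that no diagonalisation is needed: the
  spectral bounds become \<open>0 \<le> f x \<bullet> x \<le> x \<bullet> x\<close> (\<open>positive_contraction\<close>), the step is treated
  in \<open>positive_contraction_implicit_step\<close>, its powers in \<open>positive_contraction_funpow\<close>, and the
  passage from forms to norms is \<open>norm_le_if_quadratic_form_le\<close>.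
\<close>

section \<open>Operators between zero and the identity\<close>

definition self_adjoint :: "('a::real_inner \<Rightarrow> 'a) \<Rightarrow> bool"
  where "self_adjoint f \<longleftrightarrow> linear f \<and> (\<forall>x y. f x \<bullet> y = x \<bullet> f y)"

definition positive_contraction :: "('a::real_inner \<Rightarrow> 'a) \<Rightarrow> bool"
  where "positive_contraction f \<longleftrightarrow>
    self_adjoint f \<and> (\<forall>x. 0 \<le> f x \<bullet> x) \<and> (\<forall>x. f x \<bullet> x \<le> x \<bullet> x)"

text \<open>
  Polarisation bounds \<open>f x \<bullet> y\<close> by \<open>(\<parallel>x\<parallel>\<^sup>2 + \<parallel>y\<parallel>\<^sup>2) / 2\<close>; the claim follows by choosing \<open>y\<close>
  parallel to \<open>f x\<close> and as long as \<open>x\<close>.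
\<close>

lemma norm_le_if_quadratic_form_le:
  fixes f :: "'a::real_inner \<Rightarrow> 'a"
  assumes f: "self_adjoint f" and bound: "\<And>x. \<bar>f x \<bullet> x\<bar> \<le> x \<bullet> x"
  shows "norm (f x) \<le> norm x"
proof (cases "f x = 0")
  case False
  have lin: "linear f" and sym: "\<And>x y. f x \<bullet> y = x \<bullet> f y"
    using f by (auto simp: self_adjoint_def)
  have polar: "2 * (f u \<bullet> v) \<le> u \<bullet> u + v \<bullet> v" for u v
  proof -
    have "4 * (f u \<bullet> v) = f (u + v) \<bullet> (u + v) + - (f (u - v) \<bullet> (u - v))"
      using sym[of v u]
      by (simp add: linear_add[OF lin] linear_diff[OF lin] inner_simps inner_commute)
    also have "\<dots> \<le> (u + v) \<bullet> (u + v) + (u - v) \<bullet> (u - v)"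
      by (intro add_mono abs_le_D1[OF bound] abs_le_D2[OF bound])
    also have "\<dots> = 2 * (u \<bullet> u + v \<bullet> v)"
      by (simp add: inner_simps inner_commute)
    finally show ?thesis
      by simp
  qed
  define y where "y = (norm x / norm (f x)) *\<^sub>R f x"
  have "f x \<bullet> y = norm x * norm (f x)"
    using False by (simp add: y_def dot_square_norm power2_eq_square)
  moreover have "y \<bullet> y = norm x * norm x" "x \<bullet> x = norm x * norm x"
    using False by (simp_all add: y_def dot_square_norm power2_eq_square)
  ultimately have *: "norm x * norm (f x) \<le> norm x * norm x"
    using polar[of x y] by simp
  have "norm x > 0"
    using False linear_0[OF lin] by auto
  then show ?thesis
    using * by simp
qed simp

lemma positive_contraction_norm_le:
  assumes "positive_contraction f"
  shows "norm (f x) \<le> norm x"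
  using assms by (intro norm_le_if_quadratic_form_le) (auto simp: positive_contraction_def)

lemma positive_contraction_norm_diff_le:
  assumes f: "positive_contraction f" and g: "positive_contraction g"
  shows "norm (f x - g x) \<le> norm x"
proof (rule norm_le_if_quadratic_form_le)
  show "self_adjoint (\<lambda>x. f x - g x)"
    using f g by (simp add: positive_contraction_def self_adjoint_def inner_simps
        linear_compose_sub)
  show "\<bar>(f x - g x) \<bullet> x\<bar> \<le> x \<bullet> x" for x
  proof -
    have "0 \<le> f x \<bullet> x" "f x \<bullet> x \<le> x \<bullet> x" "0 \<le> g x \<bullet> x" "g x \<bullet> x \<le> x \<bullet> x"
      using f g by (auto simp: positive_contraction_def)
    then show ?thesis
      by (simp add: inner_diff_left)
  qed
qed

lemma self_adjoint_funpow:
  assumes "self_adjoint f"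
  shows "self_adjoint (f ^^ m)"
proof (induction m)
  case 0
  then show ?case
    by (simp add: self_adjoint_def linear_id flip: id_def)
next
  case (Suc m)
  have "(f ^^ Suc m) y \<bullet> z = y \<bullet> (f ^^ Suc m) z" for y z
    using assms Suc by (simp add: self_adjoint_def funpow_swap1)
  moreover have "linear (f ^^ Suc m)"
    using assms Suc by (auto simp: self_adjoint_def intro: linear_compose)
  ultimately show ?case
    unfolding self_adjoint_def by blast
qed

lemma norm_funpow_le:
  fixes f :: "'a::real_normed_vector \<Rightarrow> 'a"
  assumes "\<And>x. norm (f x) \<le> norm x"
  shows "norm ((f ^^ m) x) \<le> norm x"
proof (induction m)
  case (Suc m)
  then show ?case
    using assms[of "(f ^^ m) x"] by simp
qed simp

text \<open>
  Positivity of a power comes from splitting off half of it: \<open>f\<^sup>2\<^sup>m x \<bullet> x = f\<^sup>m x \<bullet> f\<^sup>m x\<close> and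
  \<open>f\<^sup>2\<^sup>m\<^sup>+\<^sup>1 x \<bullet> x = f (f\<^sup>m x) \<bullet> f\<^sup>m x\<close>.
\<close>

lemma positive_contraction_funpow:
  fixes f :: "'a::real_inner \<Rightarrow> 'a"
  assumes f: "positive_contraction f"
  shows "positive_contraction (f ^^ m)"
  unfolding positive_contraction_def
proof (intro conjI allI)
  have sa: "self_adjoint f" and pos: "\<And>x. 0 \<le> f x \<bullet> x"
    using f by (auto simp: positive_contraction_def)
  show "self_adjoint (f ^^ m)"
    by (rule self_adjoint_funpow[OF sa])
  fix x
  define k where "k = m div 2"
  define y where "y = (f ^^ k) x"
  have half: "(f ^^ k) u \<bullet> v = u \<bullet> (f ^^ k) v" for u v
    using self_adjoint_funpow[OF sa] by (auto simp: self_adjoint_def)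
  show "0 \<le> (f ^^ m) x \<bullet> x"
  proof (cases "even m")
    case True
    then have "m = k + k"
      by (auto simp: k_def)
    then have "(f ^^ m) x \<bullet> x = y \<bullet> y"
      by (simp add: funpow_add half y_def)
    then show ?thesis
      by simp
  next
    case False
    then have "m = k + Suc k"
      unfolding k_def by presburger
    then have "(f ^^ m) x = (f ^^ k) ((f ^^ Suc k) x)"
      by (simp only: funpow_add o_apply)
    then have "(f ^^ m) x \<bullet> x = f y \<bullet> y"
      by (simp add: half y_def)
    then show ?thesis
      using pos by simp
  qed
  have "(f ^^ m) x \<bullet> x \<le> norm ((f ^^ m) x) * norm x"
    by (rule norm_cauchy_schwarz)
  also have "\<dots> \<le> norm x * norm x"
    by (intro mult_right_mono norm_funpow_le positive_contraction_norm_le f) simp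
  finally show "(f ^^ m) x \<bullet> x \<le> x \<bullet> x"
    by (simp add: dot_square_norm power2_eq_square)
qed

section \<open>The implicit step of a dissipative operator\<close>

text \<open>
  The operator to be inverted in a step, \<open>I - aD + bD\<^sup>2\<close>, dominates the identity because \<open>-aD\<close>
  and \<open>bD\<^sup>2\<close> are both positive semidefinite. In particular it is injective.
\<close>

lemma implicit_operator_coercive:
  fixes D :: "'a::real_inner \<Rightarrow> 'a"
  assumes D: "self_adjoint D" and neg: "\<And>x. D x \<bullet> x \<le> 0" and ab: "0 \<le> a" "0 \<le> b"
  shows "y \<bullet> y \<le> (y - a *\<^sub>R D y + b *\<^sub>R D (D y)) \<bullet> y"
proof -
  have "D (D y) \<bullet> y = D y \<bullet> D y"
    using D by (auto simp: self_adjoint_def)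
  then have "(y - a *\<^sub>R D y + b *\<^sub>R D (D y)) \<bullet> y = y \<bullet> y - a * (D y \<bullet> y) + b * (D y \<bullet> D y)"
    by (simp add: inner_simps)
  then show ?thesis
    using mult_nonneg_nonpos[OF ab(1) neg[of y]] mult_nonneg_nonneg[OF ab(2) inner_ge_zero[of "D y"]]
    by linarith
qed

text \<open>
  The step \<open>S = M\<^sup>-\<^sup>1 B\<close> is characterised by \<open>M S = B\<close>. As \<open>M\<close> and \<open>B\<close> commute, \<open>S (M y) = B y\<close>.
  Substituting \<open>x = M y\<close> therefore removes the inverse from the quadratic forms:
  \<open>S x \<bullet> x = B y \<bullet> M y\<close> and \<open>(x - S x) \<bullet> x = b D\<^sup>2 y \<bullet> M y\<close>. Expanded, both are
  combinations with nonnegative coefficients of squares and of \<open>-(D (D y) \<bullet> D y)\<close>.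
\<close>

lemma positive_contraction_implicit_step:
  fixes D S :: "'a::real_inner \<Rightarrow> 'a" and a b :: real
  defines "B \<equiv> \<lambda>y. y - a *\<^sub>R D y"
  defines "M \<equiv> \<lambda>y. B y + b *\<^sub>R D (D y)"
  assumes D: "self_adjoint D" and neg: "\<And>x. D x \<bullet> x \<le> 0" and ab: "0 \<le> a" "0 \<le> b"
    and S: "linear S" "\<And>x. M (S x) = B x" and surj: "surj M"
  shows "positive_contraction S"
proof -
  have lin: "linear D" and sym: "\<And>x y. D x \<bullet> y = x \<bullet> D y"
    using D by (auto simp: self_adjoint_def)
  note D_simps = linear_add[OF lin] linear_diff[OF lin] linear_scale[OF lin]
  have commute: "B (M y) = M (B y)" for y
    by (simp add: B_def M_def D_simps algebra_simps)
  have M_inj: "u = v" if "M u = M v" for u v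
  proof -
    have "M (u - v) = M u - M v"
      by (simp add: B_def M_def D_simps algebra_simps)
    then have "M (u - v) = 0"
      using that by simp
    then have "(u - v) \<bullet> (u - v) \<le> 0"
      using implicit_operator_coercive[OF D neg ab, of "u - v"] by (simp add: M_def B_def)
    then show ?thesis
      by (metis antisym inner_eq_zero_iff inner_ge_zero right_minus_eq)
  qed
  have SM: "S (M y) = B y" for y
    by (rule M_inj) (simp add: S commute)
  have B_sym: "B u \<bullet> v = u \<bullet> B v" for u v
    by (simp add: B_def inner_simps sym)
  have M_sym: "M u \<bullet> v = u \<bullet> M v" for u v
    by (simp add: M_def inner_simps sym B_sym)
  have cross: "D (D y) \<bullet> B y = D y \<bullet> D y - a * (D (D y) \<bullet> D y)" for y
    by (simp add: B_def inner_diff_right sym[of "D y" y])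
  have cross_nonneg: "0 \<le> b * (D (D y) \<bullet> B y)" for y
  proof -
    have "0 \<le> D (D y) \<bullet> B y"
      unfolding cross using mult_nonneg_nonpos[OF ab(1) neg[of "D y"]] inner_ge_zero[of "D y"]
      by linarith
    then show ?thesis
      using ab by simp
  qed
  show ?thesis
    unfolding positive_contraction_def self_adjoint_def
  proof (intro conjI allI)
    fix x x'
    obtain y y' where y: "x = M y" "x' = M y'"
      using surj by (metis surjD)
    show "S x \<bullet> x' = x \<bullet> S x'"
      unfolding y SM by (metis B_sym M_sym commute)
    have "S x \<bullet> x = B y \<bullet> B y + b * (D (D y) \<bullet> B y)"
      unfolding y SM by (simp add: M_def inner_simps inner_commute)
    then show "0 \<le> S x \<bullet> x"
      using cross_nonneg[of y] by simp
    have "x - S x = b *\<^sub>R D (D y)"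
      unfolding y SM by (simp add: M_def)
    then have "x \<bullet> x - S x \<bullet> x = (b *\<^sub>R D (D y)) \<bullet> x"
      by (metis inner_diff_left)
    also have "\<dots> = b * (D (D y) \<bullet> B y) + (b * b) * (D (D y) \<bullet> D (D y))"
      unfolding y by (simp add: M_def inner_simps algebra_simps)
    also have "\<dots> \<ge> 0"
      by (intro add_nonneg_nonneg[OF cross_nonneg] mult_nonneg_nonneg) (use ab in auto)
    finally show "S x \<bullet> x \<le> x \<bullet> x"
      by simp
  qed (rule S)
qed

section \<open>The discrete Laplacian\<close>

definition adjacent :: "'n::{finite,linorder} \<Rightarrow> 'n \<Rightarrow> bool"
  where "adjacent i j \<longleftrightarrow> index_pos i = Suc (index_pos j) \<or> index_pos j = Suc (index_pos i)"

lemma inj_index_pos: "inj index_pos"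
proof (rule injI)
  have "index_pos i < index_pos j" if "i < j" for i j :: 'a
    unfolding index_pos_def using that by (intro psubset_card_mono) auto
  then show "i = j" if "index_pos i = index_pos j" for i j :: 'a
    using that by (metis less_irrefl linorder_neqE)
qed

lemma adjacent_commute: "adjacent i j \<longleftrightarrow> adjacent j i"
  by (auto simp: adjacent_def)

lemma card_adjacent_le: "card {j. adjacent i j} \<le> 2"
proof -
  have "card {j. adjacent i j} = card (index_pos ` {j. adjacent i j})"
    by (metis card_image inj_index_pos inj_on_subset subset_UNIV)
  also have "\<dots> \<le> card {index_pos i - 1, Suc (index_pos i)}"
    by (intro card_mono) (auto simp: adjacent_def)
  also have "\<dots> \<le> 2"
    by (simp add: card_insert_if)
  finally show ?thesis .
qed

lemma Dh_mult_component:
  fixes x :: "real ^ ('n::{finite,linorder})"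
  shows
  "(Dh h *v x) $ i = ((\<Sum>j | adjacent i j. x $ j) - 2 * x $ i) / h\<^sup>2"
proof -
  have "(Dh h *v x) $ i
      = (\<Sum>j\<in>UNIV. (if j = i then - 2 / h\<^sup>2 * x $ j else 0)
          + (if adjacent i j then x $ j / h\<^sup>2 else 0))"
    unfolding matrix_vector_mult_def Dh_def
    by (auto simp: adjacent_def intro!: sum.cong)
  also have "\<dots> = - 2 / h\<^sup>2 * x $ i + (\<Sum>j | adjacent i j. x $ j / h\<^sup>2)"
    by (simp add: sum.distrib sum.delta flip: sum.inter_filter)
  also have "\<dots> = ((\<Sum>j | adjacent i j. x $ j) - 2 * x $ i) / h\<^sup>2"
    by (simp add: sum_divide_distrib[symmetric] diff_divide_distrib)
  finally show ?thesis .
qed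

lemma self_adjoint_Dh:
  "self_adjoint ((*v) (Dh h :: real ^ ('n::{finite,linorder}) ^ ('n::{finite,linorder})))"
proof -
  have "transpose (Dh h) = (Dh h :: real ^ ('n::{finite,linorder}) ^ ('n::{finite,linorder}))"
    unfolding transpose_def Dh_def by (auto simp: vec_eq_iff)
  then show ?thesis
    unfolding self_adjoint_def
    by (metis dot_lmul_matrix matrix_vector_mul_linear transpose_matrix_vector)
qed

text \<open>
  Diagonal dominance: \<open>x\<^sub>i x\<^sub>j \<le> (x\<^sub>i\<^sup>2 + x\<^sub>j\<^sup>2) / 2\<close> for each of the at most two neighbours \<open>j\<close> of
  \<open>i\<close>, so that the off-diagonal part is absorbed by the diagonal.
\<close>

lemma Dh_nonpos:
  fixes x :: "real ^ ('n::{finite,linorder})"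
  shows "(Dh h *v x) \<bullet> x \<le> 0"
proof -
  let ?deg = "\<lambda>i. real (card {j. adjacent i j})"
  have row: "(\<Sum>i\<in>UNIV. \<Sum>j | adjacent i j. (x $ i)\<^sup>2) = (\<Sum>i\<in>UNIV. ?deg i * (x $ i)\<^sup>2)"
    by simp
  have col: "(\<Sum>i\<in>UNIV. \<Sum>j | adjacent i j. (x $ j)\<^sup>2) = (\<Sum>i\<in>UNIV. ?deg i * (x $ i)\<^sup>2)"
  proof -
    have "(\<Sum>i\<in>UNIV. \<Sum>j | adjacent i j. (x $ j)\<^sup>2) = (\<Sum>i\<in>UNIV. \<Sum>j | adjacent j i. (x $ i)\<^sup>2)"
      using sum.swap_restrict[of UNIV UNIV "\<lambda>i j. (x $ j)\<^sup>2" adjacent] by simp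
    then show ?thesis
      by (simp add: adjacent_commute)
  qed
  have "(\<Sum>i\<in>UNIV. \<Sum>j | adjacent i j. x $ j * x $ i)
      \<le> (\<Sum>i\<in>UNIV. \<Sum>j | adjacent i j. ((x $ i)\<^sup>2 + (x $ j)\<^sup>2) / 2)"
  proof (intro sum_mono)
    show "x $ j * x $ i \<le> ((x $ i)\<^sup>2 + (x $ j)\<^sup>2) / 2" for i j
      using sum_squares_bound[of "x $ i" "x $ j"] by (simp add: algebra_simps)
  qed
  also have "\<dots> = (\<Sum>i\<in>UNIV. ?deg i * (x $ i)\<^sup>2)"
    using row col by (simp add: sum.distrib flip: sum_divide_distrib)
  also have "\<dots> \<le> (\<Sum>i\<in>UNIV. 2 * (x $ i)\<^sup>2)"
    using card_adjacent_le by (intro sum_mono mult_right_mono) (auto simp: numeral_eq_of_nat)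
  finally have "(\<Sum>i\<in>UNIV. (\<Sum>j | adjacent i j. x $ j) * x $ i) \<le> (\<Sum>i\<in>UNIV. 2 * (x $ i)\<^sup>2)"
    by (simp add: sum_distrib_right)
  moreover have "(Dh h *v x) \<bullet> x
      = ((\<Sum>i\<in>UNIV. (\<Sum>j | adjacent i j. x $ j) * x $ i) - (\<Sum>i\<in>UNIV. 2 * (x $ i)\<^sup>2)) / h\<^sup>2"
    by (simp add: inner_vec_def Dh_mult_component sum_subtractf[symmetric] sum_divide_distrib
        algebra_simps power2_eq_square)
  ultimately show ?thesis
    by (simp add: divide_nonpos_nonneg)
qed

section \<open>The coarse and the fine propagator\<close>

lemma positive_contraction_step_matrix:
  assumes "0 \<le> \<tau>"
  shows "positive_contraction
    ((*v) (step_matrix i h \<epsilon> \<tau> :: real ^ ('n::{finite,linorder}) ^ ('n::{finite,linorder})))"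
proof -
  define D :: "real ^ ('n::{finite,linorder}) ^ ('n::{finite,linorder})" where "D = Dh h"
  define a b where "a = real i * \<tau>" and "b = \<epsilon>\<^sup>2 * \<tau>"
  define M where "M = mat 1 - a *\<^sub>R D + b *\<^sub>R (D ** D)"
  have ab: "0 \<le> a" "0 \<le> b"
    using assms by (auto simp: a_def b_def)
  have D: "self_adjoint ((*v) D)" "\<And>x. (D *v x) \<bullet> x \<le> 0"
    by (auto simp: D_def self_adjoint_Dh Dh_nonpos)
  have B_apply: "(mat 1 - a *\<^sub>R D) *v y = y - a *\<^sub>R (D *v y)" for y
    by (simp add: matrix_vector_mult_diff_rdistrib scaleR_matrix_vector_assoc)
  have M_apply: "M *v y = y - a *\<^sub>R (D *v y) + b *\<^sub>R (D *v (D *v y))" for y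
    by (simp add: M_def B_apply matrix_vector_mult_add_rdistrib matrix_vector_mul_assoc
        flip: scaleR_matrix_vector_assoc)
  have "y = 0" if "M *v y = 0" for y
  proof -
    have "y \<bullet> y \<le> (M *v y) \<bullet> y"
      unfolding M_apply by (rule implicit_operator_coercive[OF D ab])
    then show ?thesis
      using that by (metis antisym inner_eq_zero_iff inner_ge_zero inner_zero_left)
  qed
  then have "invertible M"
    by (simp add: invertible_left_inverse matrix_left_invertible_ker)
  then have inv: "M ** matrix_inv M = mat 1"
    unfolding invertible_def matrix_inv_def by (metis (mono_tags, lifting) someI_ex)
  have step: "step_matrix i h \<epsilon> \<tau> = matrix_inv M ** (mat 1 - a *\<^sub>R D)"
    by (simp add: step_matrix_def M_def D_def a_def b_def)
  show ?thesis
    unfolding step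
  proof (rule positive_contraction_implicit_step[OF D ab], unfold M_apply[symmetric])
    show "M *v ((matrix_inv M ** (mat 1 - a *\<^sub>R D)) *v x) = x - a *\<^sub>R (D *v x)" for x
      by (metis B_apply inv matrix_mul_assoc matrix_mul_lid matrix_vector_mul_assoc)
    show "surj ((*v) M)"
      using inv by (auto simp: matrix_right_invertible_surjective[symmetric])
  qed simp
qed

lemma matrix_power_mult_vector: "(*v) (matrix_power A m) = (*v) A ^^ m"
  by (induction m) (auto simp: fun_eq_iff simp flip: matrix_vector_mul_assoc)

section \<open>Growth of the Parareal iterates\<close>

text \<open>
  The recursion reads \<open>U\<^sub>n\<^sub>+\<^sub>1\<^sup>k\<^sup>+\<^sup>1 = G U\<^sub>n\<^sup>k\<^sup>+\<^sup>1 + (F - G) U\<^sub>n\<^sup>k\<close>: each time step adds at most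
  \<open>\<parallel>U\<^sub>n\<^sup>k\<parallel>\<close> to the norm.
\<close>

lemma norm_parareal_le_sum:
  fixes F G :: "'a::real_normed_vector \<Rightarrow> 'a"
  assumes G: "\<And>x. norm (G x) \<le> norm x" and FG: "\<And>x. norm (F x - G x) \<le> norm x"
  shows "norm (parareal F G u0 (Suc k) n) \<le> norm u0 + (\<Sum>j<n. norm (parareal F G u0 k j))"
proof (induction n)
  case (Suc n)
  let ?U = "parareal F G u0"
  have "norm (?U (Suc k) (Suc n)) = norm (G (?U (Suc k) n) + (F (?U k n) - G (?U k n)))"
    by (simp add: algebra_simps)
  also have "\<dots> \<le> norm (?U (Suc k) n) + norm (?U k n)"
    by (rule norm_triangle_mono[OF G FG])
  finally show ?case
    using Suc by simp
qed simp

theorem theorem3p10: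
  fixes h \<epsilon> T :: real and N\<^sub>x N J :: nat
    and u0 :: "real ^ ('n::{finite,linorder})"
  assumes "h > 0" and "N\<^sub>x \<ge> 3" and "CARD('n) = N\<^sub>x - 2"
    and "\<epsilon> > 0" and "T > 0" and "N \<ge> 1" and "J \<ge> 2"
  shows "\<forall>n\<in>{0..N-1}. \<forall>k.
    norm (PA_III h \<epsilon> T N J u0 (k + 1) (n + 1))
      \<le> norm u0 + real (n + 1) * (MAX j\<in>{0..n}. norm (PA_III h \<epsilon> T N J u0 k j))"
proof (intro ballI allI)
  fix n k
  define F :: "real ^ ('n::{finite,linorder}) \<Rightarrow> real ^ ('n::{finite,linorder})"
    where "F = (*v) (P_fine J 2 h \<epsilon> (T / real N))"
  define G :: "real ^ ('n::{finite,linorder}) \<Rightarrow> real ^ ('n::{finite,linorder})"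
    where "G = (*v) (P_coarse 1 h \<epsilon> (T / real N))"
  have F: "positive_contraction F"
    unfolding F_def P_fine_def matrix_power_mult_vector
    using \<open>T > 0\<close> by (intro positive_contraction_funpow positive_contraction_step_matrix) simp
  have G: "positive_contraction G"
    unfolding G_def P_coarse_def
    using \<open>T > 0\<close> by (intro positive_contraction_step_matrix) simp
  have U: "PA_III h \<epsilon> T N J u0 = parareal F G u0"
    by (simp add: PA_III_def Let_def F_def G_def)
  let ?U = "parareal F G u0"
  have "norm (?U (Suc k) (Suc n)) \<le> norm u0 + (\<Sum>j<Suc n. norm (?U k j))"
    by (intro norm_parareal_le_sum positive_contraction_norm_le[OF G]
        positive_contraction_norm_diff_le[OF F G])
  also have "(\<Sum>j<Suc n. norm (?U k j))
      \<le> real (card {..<Suc n}) * (MAX j\<in>{0..n}. norm (?U k j))"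
    by (intro sum_bounded_above Max_ge) auto
  finally show "norm (PA_III h \<epsilon> T N J u0 (k + 1) (n + 1))
      \<le> norm u0 + real (n + 1) * (MAX j\<in>{0..n}. norm (PA_III h \<epsilon> T N J u0 k j))"
    by (simp add: U)
qed

end
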